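(* Let $d\ge 1$, let $f:\mathbb{R}^d\to\mathbb{R}$ be convex and smooth (differentiable), and let $x\in\mathbb{R}^d$, $\lambda\ge 0$, $\eta>0$. Let $\tilde h\in\mathbb{R}^d$ and $\tilde x\in\mathbb{R}^d$ be the output of the SOTOPO algorithm (described in the context) on input $(\nabla f(x),x,\lambda,\eta)$. Then $\tilde h$ is an exact minimizer of the $\ell_1$-regularized $\ell_1$-norm square approximation problem $$\min_{g\in\mathbb{R}^d}\left\{\langle\nabla f(x),g\rangle+\frac{1}{2\eta}\|g\|_1^2+\lambda\|x+g\|_1\right\},$$ and $\tilde x=x+\tilde h$.
   Context: Notation: $[d]=\{1,\dots,d\}$; $\nabla_i f(x)$ is the $i$-th entry of $\nabla f(x)$. For $i\in[d]$ and $\theta_i\in[0,1]$ put $$\tilde g_i(\theta_i)=\mathrm{sign}(x_i-\theta_i\eta\nabla_i f(x))\cdot\max\{0,|x_i-\theta_i\eta\nabla_i f(x)|-\theta_i\eta\lambda\}-x_i,$$ $$J_i(\theta_i)=\nabla_i f(x)\,\tilde g_i(\theta_i)+\frac{1}{2\eta}\frac{\tilde g_i(\theta_i)^2}{\theta_i}+\lambda|x_i+\tilde g_i(\theta_i)|,$$ with the convention $0/0=0$ (note $\tilde g_i(0)=0$). $J_i'$ denotes the derivative of $J_i$ on $[0,1]$ (one-sided at the endpoints $0$ and $1$). The SOTOPO algorithm on input $(\nabla f(x),x,\lambda,\eta)$: 1) Let $v_m=\max_{i\in[d]}\{-J_i'(1)\}$, let $i_m\in\arg\max_{i\in[d]}\{-J_i'(1)\}$,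 and let $Q=\{i\in[d] : -J_i'(0)>v_m\}$. 2) Sort $\{-J_i'(0): i\in Q\}$ so that $-J'_{i_1}(0)\ge -J'_{i_2}(0)\ge\cdots\ge -J'_{i_{|Q|}}(0)$, where $(i_1,\dots,i_{|Q|})$ is a permutation of the elements of $Q$. Set $v_j=-J'_{i_j}(0)$ for $1\le j\le |Q|$, $v_{|Q|+1}=v_m$, and $i_{|Q|+1}=i_m$. 3) For $j\in\{1,\dots,|Q|+1\}$ let $R_j=\{i_k : k\in[j]\}$ (a set; possibly $i_{|Q|+1}\in R_{|Q|}$), and $R_0=\emptyset$. Let $\rho$ be the smallest $j\in\{1,\dots,|Q|+1\}$ such that $J'_{i_j}(0)=J'_{i_j}(1)$, or $\sum_{l\in R_j}|x_l|\ge\sqrt{2\eta v_j}$, or $j=|Q|+1$. 4) Let $\tilde\gamma=\big(\sum_{l\in R_{\rho-1}}|x_l|\big)^2/(2\eta)$ if $\sum_{l\in R_{\rho-1}}|x_l|\ge\sqrt{2\eta v_\rho}$, and $\tilde\gamma=v_\rho$ otherwise. 5) Define $$(\tilde\theta_l,\tilde h_l,\tilde x_l)=\begin{cases}\left(\frac{|x_l|}{\sqrt{2\eta\tilde\gamma}},\,-x_l,\,0\right), & l\in R_\rho\setminus\{i_\rho\},\\ \left(1-\sum_{k\in R_\rho\setminus\{i_\rho\}}\tilde\theta_k,\ \tilde g_l(\tilde\theta_l),\ x_l+\tilde g_l(\tilde\theta_l)\right), & l=i_\rho,\\ (0,0,x_l), & l\in[d]\setminus R_\rho,\end{cases}$$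 and output $\tilde h$, $\tilde x$. *)

theory Defs
  imports "HOL-Analysis.Analysis"
begin

definition l1_norm :: "real^'n \<Rightarrow> real" where
  "l1_norm y = (\<Sum>i\<in>UNIV. \<bar>y $ i\<bar>)"

definition l1_square_objective ::
    "real^'n \<Rightarrow> real^'n \<Rightarrow> real \<Rightarrow> real \<Rightarrow> real^'n \<Rightarrow> real" where
  "l1_square_objective G x lam eta g =
     G \<bullet> g + 1 / (2 * eta) * (l1_norm g)\<^sup>2 + lam * l1_norm (x + g)"

text \<open>
  The SOTOPO algorithm. \<open>G\<close> is the gradient at \<open>x\<close>; the coordinates \<open>{1..d}\<close> are the elements of
  the finite type \<open>'n\<close>.
\<close>

context
  fixes G x :: "real^'n" and lam eta :: real
begin

definition sotopo_g :: "'n \<Rightarrow> real \<Rightarrow> real" where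
  "sotopo_g i t =
     sgn (x $ i - t * eta * G $ i) * max 0 (\<bar>x $ i - t * eta * G $ i\<bar> - t * eta * lam) - x $ i"

text \<open>The convention \<open>0 / 0 = 0\<close> needed at \<open>t = 0\<close> is the one built into HOL division.\<close>

definition sotopo_J :: "'n \<Rightarrow> real \<Rightarrow> real" where
  "sotopo_J i t =
     G $ i * sotopo_g i t + 1 / (2 * eta) * ((sotopo_g i t)\<^sup>2 / t) + lam * \<bar>x $ i + sotopo_g i t\<bar>"

text \<open>Restricting to \<open>{0..1}\<close> makes the derivative one-sided at both endpoints.\<close>

definition sotopo_J' :: "'n \<Rightarrow> real \<Rightarrow> real" where
  "sotopo_J' i t = vector_derivative (sotopo_J i) (at t within {0..1})"

definition sotopo_vm :: real where
  "sotopo_vm = Max (range (\<lambda>i. - sotopo_J' i 1))"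

definition sotopo_Q :: "'n set" where
  "sotopo_Q = {i. - sotopo_J' i 0 > sotopo_vm}"

text \<open>
  The algorithm leaves two choices open: the maximizing index \<open>im\<close> and, in case of ties, the order
  in which \<open>Q\<close> is enumerated by the list \<open>qs\<close>.
\<close>

definition sotopo_choice :: "'n \<Rightarrow> 'n list \<Rightarrow> bool" where
  "sotopo_choice im qs \<longleftrightarrow>
     - sotopo_J' im 1 = sotopo_vm \<and>
     distinct qs \<and> set qs = sotopo_Q \<and>
     sorted_wrt (\<lambda>k l. - sotopo_J' k 0 \<ge> - sotopo_J' l 0) qs"

context
  fixes im :: 'n and qs :: "'n list"
begin

text \<open>The positions \<open>j\<close> below range over \<open>{1..|Q| + 1}\<close>, where \<open>|Q| = length qs\<close>.\<close>

definition sotopo_idx :: "nat \<Rightarrow> 'n" where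
  "sotopo_idx j = (if j \<le> length qs then qs ! (j - 1) else im)"

definition sotopo_v :: "nat \<Rightarrow> real" where
  "sotopo_v j = (if j \<le> length qs then - sotopo_J' (sotopo_idx j) 0 else sotopo_vm)"

definition sotopo_R :: "nat \<Rightarrow> 'n set" where
  "sotopo_R j = sotopo_idx ` {1..j}"

definition sotopo_rho :: nat where
  "sotopo_rho = (LEAST j. j \<in> {1..length qs + 1} \<and>
     (sotopo_J' (sotopo_idx j) 0 = sotopo_J' (sotopo_idx j) 1 \<or>
      (\<Sum>l\<in>sotopo_R j. \<bar>x $ l\<bar>) \<ge> sqrt (2 * eta * sotopo_v j) \<or>
      j = length qs + 1))"

definition sotopo_gamma :: real where
  "sotopo_gamma =
     (if (\<Sum>l\<in>sotopo_R (sotopo_rho - 1). \<bar>x $ l\<bar>) \<ge> sqrt (2 * eta * sotopo_v sotopo_rho)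
      then (\<Sum>l\<in>sotopo_R (sotopo_rho - 1). \<bar>x $ l\<bar>)\<^sup>2 / (2 * eta)
      else sotopo_v sotopo_rho)"

text \<open>The last coordinate \<open>i\<^sub>\<rho>\<close> processed, and the coordinates \<open>R\<^sub>\<rho> - {i\<^sub>\<rho>}\<close>.\<close>

definition sotopo_last :: 'n where
  "sotopo_last = sotopo_idx sotopo_rho"

definition sotopo_zeroed :: "'n set" where
  "sotopo_zeroed = sotopo_R sotopo_rho - {sotopo_last}"

definition sotopo_theta :: "'n \<Rightarrow> real" where
  "sotopo_theta l =
     (if l \<in> sotopo_zeroed then \<bar>x $ l\<bar> / sqrt (2 * eta * sotopo_gamma)
      else if l = sotopo_last
        then 1 - (\<Sum>k\<in>sotopo_zeroed. \<bar>x $ k\<bar> / sqrt (2 * eta * sotopo_gamma))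
      else 0)"

definition sotopo_h :: "real^'n" where
  "sotopo_h = (\<chi> l. if l \<in> sotopo_zeroed then - x $ l
                 else if l = sotopo_last then sotopo_g l (sotopo_theta l)
                 else 0)"

definition sotopo_x :: "real^'n" where
  "sotopo_x = (\<chi> l. if l \<in> sotopo_zeroed then 0
                 else if l = sotopo_last then x $ l + sotopo_g l (sotopo_theta l)
                 else x $ l)"

end

definition sotopo_output :: "real^'n \<Rightarrow> real^'n \<Rightarrow> bool" where
  "sotopo_output h x' \<longleftrightarrow>
     (\<exists>im qs. sotopo_choice im qs \<and> h = sotopo_h im qs \<and> x' = sotopo_x im qs)"

lemma sotopo_output_exists: "\<exists>h x'. sotopo_output h x'"
proof -
  have "sotopo_vm \<in> range (\<lambda>i. - sotopo_J' i 1)"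
    unfolding sotopo_vm_def by (rule Max_in) auto
  then obtain im where im: "- sotopo_J' im 1 = sotopo_vm"
    by auto
  obtain ps where ps: "set ps = sotopo_Q" "distinct ps"
    using finite_distinct_list[of sotopo_Q] by auto
  define qs where "qs = sort_key (\<lambda>k. sotopo_J' k 0) ps"
  have "sorted (map (\<lambda>k. sotopo_J' k 0) qs)"
    by (simp add: qs_def)
  then have "sorted_wrt (\<lambda>k l. - sotopo_J' k 0 \<ge> - sotopo_J' l 0) qs"
    by (simp add: sorted_wrt_map)
  then have "sotopo_choice im qs"
    using im ps by (simp add: sotopo_choice_def qs_def)
  then show ?thesis
    unfolding sotopo_output_def by blast
qed

end

end

theory Submission
  imports Defs
begin

text \<open>
  The square of the $\ell_1$-norm couples the coordinates only through the number
  \<open>T = l1_norm h\<close>. Since \<open>N\<^sup>2 / (2 * eta) \<ge> T\<^sup>2 / (2 * eta) + (T / eta) * (N - T)\<close>, with equality at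
  \<open>N = T\<close>, a vector \<open>h\<close> with \<open>l1_norm h = T\<close> is a global minimizer as soon as each of its
  entries minimizes \<open>G $ i * u + (T / eta) * \<bar>u\<bar> + lam * \<bar>x $ i + u\<bar>\<close>, a convex problem in one real
  variable in which \<open>T / eta\<close> is the price of a unit of movement (\<open>minimizer_if_optimal_at\<close>).
  It remains to see that the algorithm finds a \<open>T\<close> and an \<open>h\<close> that fit together in this way.

  The function \<open>sotopo_g\<close> is minus a clipping:
  \<open>- sotopo_g i t\<close> is \<open>x $ i\<close> clipped to the interval from \<open>t * eta * (G $ i - lam)\<close> to
  \<open>t * eta * (G $ i + lam)\<close>. It minimizes the one-coordinate problem at the price that belongs to
  \<open>T = \<bar>sotopo_g i t\<bar> / t\<close>, so this ratio, the movement per unit of budget \<open>t\<close>, is the quantity to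
  follow. For \<open>t\<close> in \<open>]0, 1]\<close> it lies between its value at \<open>1\<close> (\<open>final_rate\<close>) and its limit at
  \<open>0\<close> (\<open>initial_rate\<close>), and the derivative of \<open>J i\<close> is minus the square of the ratio divided by
  \<open>2 * eta\<close>. Hence the numbers that the algorithm compares are these rates: \<open>initial_rate i\<close> and
  \<open>final_rate i\<close> are \<open>sqrt (2 * eta * v)\<close> for \<open>v = - J' i 0\<close> and \<open>v = - J' i 1\<close>
  (\<open>initial_rate_eq\<close>, \<open>final_rate_eq\<close>).

  In terms of the rates, staying put is optimal at \<open>T\<close> if \<open>initial_rate i \<le> T\<close>, and cancelling
  \<open>x $ i\<close> is optimal if \<open>final_rate i \<le> T \<le> initial_rate i\<close>, \<open>\<bar>x $ i\<bar> \<le> T\<close> and the two rates differ.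
  With \<open>T = sqrt (2 * eta * gamma)\<close>, which is the maximum of the mass cancelled so far and the
  rate threshold at the stopping position, the sorting of \<open>Q\<close> and the stopping rule give the first
  condition for the coordinates that are not reached and the second for those that are cancelled.
  The last coordinate receives the budget \<open>t\<close> that is left; a case distinction on the reason for
  stopping shows that it moves by exactly \<open>t * T\<close> (\<open>last_coordinate\<close>). This
  brings the total movement to \<open>T\<close> and, for \<open>t > 0\<close>, makes the move optimal at \<open>T\<close>; for \<open>t = 0\<close>
  the coordinate stays put, and its initial rate is at most \<open>T\<close>.
\<close>

section \<open>Clipping\<close>

definition clip :: "real \<Rightarrow> real \<Rightarrow> real \<Rightarrow> real" where
  "clip a b y = max a (min b y)"

text \<open>The limit of \<open>clip a b (y / t)\<close> as \<open>t\<close> tends to \<open>0\<close> from the right, for \<open>a \<le> b\<close>.\<close>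

definition limit_clip :: "real \<Rightarrow> real \<Rightarrow> real \<Rightarrow> real" where
  "limit_clip a b y = (if y > 0 then b else if y < 0 then a else clip a b 0)"

lemma clip_scale:
  assumes "t > 0"
  shows "clip (t * a) (t * b) y = t * clip a b (y / t)"
proof -
  have "t * (y / t) = y" using assms by simp
  then show ?thesis
    using assms unfolding clip_def
    by (metis max_mult_distrib_left min_mult_distrib_left less_imp_le not_less)
qed

text \<open>
  For nonzero \<open>t\<close> and \<open>y\<close>, division by \<open>t\<close> turns the condition into the statement that
  \<open>y / t\<close> is at least as far from \<open>0\<close> as the endpoint to which points beyond it are clipped. So clipping has reached its limit.
\<close>

lemma clip_eq_limit:
  assumes "a \<le> b" "0 \<le> t" "y = 0 \<or> t * \<bar>limit_clip a b y\<bar> \<le> \<bar>y\<bar>"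
  shows "clip (t * a) (t * b) y = t * limit_clip a b y"
proof (cases "t = 0")
  case True then show ?thesis by (simp add: clip_def)
next
  case False
  then have t: "t > 0" using assms by simp
  define w where "w = y / t"
  have sg: "w > 0 \<longleftrightarrow> y > 0" "w < 0 \<longleftrightarrow> y < 0" using t by (auto simp: w_def field_simps)
  have "w = 0 \<or> \<bar>limit_clip a b y\<bar> \<le> \<bar>w\<bar>"
    using assms(3) t by (auto simp: w_def field_simps)
  then have "clip a b w = limit_clip a b y"
    using sg assms(1) by (auto simp: clip_def limit_clip_def max_def min_def split: if_splits)
  then show ?thesis using clip_scale[OF t] by (simp add: w_def)
qed

text \<open>
  Put \<open>w = y / t\<close>, so that \<open>clip (t * a) (t * b) y = t * clip a b w\<close>. As \<open>t\<close> decreases from \<open>1\<close> to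
  \<open>0\<close>, the point \<open>w\<close> moves away from \<open>0\<close> on its side, starting at \<open>y\<close>. Therefore
  \<open>\<bar>clip a b w\<bar>\<close> increases weakly from \<open>\<bar>clip a b y\<bar>\<close> to \<open>\<bar>limit_clip a b y\<bar>\<close>: it is constant while \<open>w\<close> is short of
  the interval (third claim), equal to \<open>\<bar>w\<bar>\<close> while \<open>w\<close> is inside (fourth claim), and constant
  afterwards. In the fourth claim the strict inequality excludes a \<open>w\<close> that starts beyond the
  interval and is never inside.
\<close>

lemma
  assumes "a \<le> b" "0 < t" "t \<le> 1"
  shows clip_ge_final: "t * \<bar>clip a b y\<bar> \<le> \<bar>clip (t * a) (t * b) y\<bar>"
    and clip_le_limit: "\<bar>clip (t * a) (t * b) y\<bar> \<le> t * \<bar>limit_clip a b y\<bar>"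
    and clip_eq_final: "\<bar>y\<bar> < t * \<bar>clip a b y\<bar> \<Longrightarrow> \<bar>clip (t * a) (t * b) y\<bar> = t * \<bar>clip a b y\<bar>"
    and clip_eq_self: "\<bar>clip a b y\<bar> < \<bar>limit_clip a b y\<bar> \<Longrightarrow> t * \<bar>clip a b y\<bar> \<le> \<bar>y\<bar> \<Longrightarrow>
      \<bar>y\<bar> \<le> t * \<bar>limit_clip a b y\<bar> \<Longrightarrow> clip (t * a) (t * b) y = y"
proof -
  define w where "w = y / t"
  have sg: "w > 0 \<longleftrightarrow> y > 0" "w < 0 \<longleftrightarrow> y < 0"
    using assms by (auto simp: w_def field_simps)
  have y: "y = t * w" using assms by (simp add: w_def)
  have abs: "\<bar>y\<bar> = t * \<bar>w\<bar>" using assms y by (simp add: abs_mult)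
  have le: "\<bar>y\<bar> \<le> \<bar>w\<bar>"
    unfolding abs using assms by (simp add: mult_left_le_one_le)
  have sc: "clip (t * a) (t * b) y = t * clip a b w"
    using clip_scale assms by (simp add: w_def)
  have sca: "\<bar>clip (t * a) (t * b) y\<bar> = t * \<bar>clip a b w\<bar>"
    using assms by (simp add: sc abs_mult)
  have "\<bar>clip a b y\<bar> \<le> \<bar>clip a b w\<bar>"
    using sg le assms(1) by (auto simp: clip_def max_def min_def split: if_splits)
  then show "t * \<bar>clip a b y\<bar> \<le> \<bar>clip (t * a) (t * b) y\<bar>"
    using assms by (simp add: sca)
  have "\<bar>clip a b w\<bar> \<le> \<bar>limit_clip a b y\<bar>"
    using sg assms(1)
    by (auto simp: clip_def limit_clip_def max_def min_def split: if_splits)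
  then show "\<bar>clip (t * a) (t * b) y\<bar> \<le> t * \<bar>limit_clip a b y\<bar>"
    using assms by (simp add: sca)
  show "\<bar>clip (t * a) (t * b) y\<bar> = t * \<bar>clip a b y\<bar>" if "\<bar>y\<bar> < t * \<bar>clip a b y\<bar>"
  proof -
    have "\<bar>w\<bar> < \<bar>clip a b y\<bar>" using that assms abs by simp
    then have "\<bar>clip a b w\<bar> = \<bar>clip a b y\<bar>"
      using sg le assms(1) by (auto simp: clip_def max_def min_def split: if_splits)
    then show ?thesis by (simp add: sca)
  qed
  show "clip (t * a) (t * b) y = y"
    if lt: "\<bar>clip a b y\<bar> < \<bar>limit_clip a b y\<bar>" and "t * \<bar>clip a b y\<bar> \<le> \<bar>y\<bar>"
      and "\<bar>y\<bar> \<le> t * \<bar>limit_clip a b y\<bar>"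
  proof -
    have "\<bar>clip a b y\<bar> \<le> \<bar>w\<bar>" "\<bar>w\<bar> \<le> \<bar>limit_clip a b y\<bar>" using that assms abs by auto
    moreover have "a \<le> clip a b y" "clip a b y \<le> b"
      using assms(1) by (auto simp: clip_def)
    moreover have "y \<noteq> 0" using lt by (auto simp: limit_clip_def)
    moreover have "b > 0" if "y > 0"
      using lt that assms(1) by (rule_tac ccontr) (simp add: clip_def limit_clip_def)
    moreover have "a < 0" if "y < 0"
      using lt that assms(1) by (rule_tac ccontr) (simp add: clip_def limit_clip_def)
    ultimately have "a \<le> w \<and> w \<le> b"
      using sg by (cases "y > 0") (simp_all add: limit_clip_def)
    then have "clip a b w = w" by (simp add: clip_def)
    then show ?thesis by (simp add: sc y[symmetric])
  qed
qed

section \<open>The linearized one-coordinate problem\<close>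

text \<open>
  The first-order condition: \<open>m\<close> and \<open>n\<close> are subgradients of the two absolute value terms at \<open>u\<close>,
  and they balance the slope \<open>G\<close>.
\<close>

lemma coordinate_min_if_multipliers:
  fixes G x u v lam s m n :: real
  assumes "G + m + n = 0" "\<bar>m\<bar> \<le> lam" "\<bar>n\<bar> \<le> s"
    and "m * (x + u) = lam * \<bar>x + u\<bar>" "n * u = s * \<bar>u\<bar>"
  shows "G * u + s * \<bar>u\<bar> + lam * \<bar>x + u\<bar> \<le> G * v + s * \<bar>v\<bar> + lam * \<bar>x + v\<bar>"
proof -
  have bound: "a * b \<le> c * \<bar>b\<bar>" if "\<bar>a\<bar> \<le> c" for a b c :: real
  proof -
    have "a * b \<le> \<bar>a\<bar> * \<bar>b\<bar>" by (simp flip: abs_mult)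
    also have "\<dots> \<le> c * \<bar>b\<bar>" using that by (rule mult_right_mono) simp
    finally show ?thesis .
  qed
  have "m * (x + v) \<le> lam * \<bar>x + v\<bar>" "n * v \<le> s * \<bar>v\<bar>"
    using assms(2,3) by (simp_all add: bound)
  moreover have "G * u + n * u + m * (x + u) = (G + m + n) * u + m * x"
    "G * v + n * v + m * (x + v) = (G + m + n) * v + m * x" by algebra+
  ultimately show ?thesis using assms by simp
qed

text \<open>
  A proximal step with quadratic term \<open>u\<^sup>2 / (2 * eta * t)\<close> also solves the problem with the linear
  term \<open>s * \<bar>u\<bar>\<close> of the same slope. The subgradient \<open>n = u / (t * eta)\<close> serves both, and clipping
  is what puts the complementary \<open>m = - G - n\<close> into the range from \<open>- lam\<close> to \<open>lam\<close>, at the right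
  end of it when \<open>x + u\<close> is nonzero.
\<close>

lemma coordinate_min_clip:
  fixes G x lam eta t v :: real
  assumes lam: "lam \<ge> 0" and eta: "eta > 0" and t: "t > 0"
  defines "u \<equiv> - clip (t * (eta * (G - lam))) (t * (eta * (G + lam))) x"
  defines "s \<equiv> \<bar>u\<bar> / (t * eta)"
  shows "G * u + s * \<bar>u\<bar> + lam * \<bar>x + u\<bar> \<le> G * v + s * \<bar>v\<bar> + lam * \<bar>x + v\<bar>"
proof (rule coordinate_min_if_multipliers)
  define n where "n = u / (t * eta)"
  have te: "t * eta > 0" using t eta by simp
  have u: "u = t * eta * n" using te t eta by (simp add: n_def)
  have uc: "- u = max (t * eta * (G - lam)) (min (t * eta * (G + lam)) x)"
    by (simp add: u_def clip_def mult.assoc)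
  have ord: "t * eta * (G - lam) \<le> t * eta * (G + lam)"
    using te lam by (intro mult_left_mono) auto
  show "G + (- G - n) + n = 0" by simp
  show "\<bar>n\<bar> \<le> s" using te by (simp add: n_def s_def)
  show "n * u = s * \<bar>u\<bar>" by (simp add: n_def s_def)
  have "t * eta * (G - lam) \<le> t * eta * (- n)" "t * eta * (- n) \<le> t * eta * (G + lam)"
    using uc ord u by auto
  then have "G - lam \<le> - n" "- n \<le> G + lam"
    using te by (blast intro: mult_left_le_imp_le)+
  then show "\<bar>- G - n\<bar> \<le> lam" by linarith
  show "(- G - n) * (x + u) = lam * \<bar>x + u\<bar>"
  proof (cases "x + u = 0")
    case False
    then consider "x + u > 0" "t * eta * (- n) = t * eta * (G + lam)"
      | "x + u < 0" "t * eta * (- n) = t * eta * (G - lam)"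
      using uc u ord by (fastforce simp: max_def min_def split: if_splits)
    then show ?thesis
    proof cases
      case 1
      then have "- n = G + lam" using te by (metis mult_cancel_left less_irrefl)
      then have "- G - n = lam" by simp
      then show ?thesis using 1 by simp
    next
      case 2
      then have "- n = G - lam" using te by (metis mult_cancel_left less_irrefl)
      then have "- G - n = - lam" by simp
      then show ?thesis using 2 by (simp add: algebra_simps)
    qed
  qed simp
qed

text \<open>
  The limit of the preceding lemma for \<open>t\<close> tending to \<open>0\<close>: the step vanishes, and \<open>n\<close> tends to
  \<open>- p\<close>, where \<open>p\<close> is the limit of clipping divided by \<open>eta\<close>.
\<close>

lemma coordinate_min_zero:
  fixes G x lam eta s v :: real
  assumes lam: "lam \<ge> 0" and eta: "eta > 0"
    and le: "\<bar>limit_clip (eta * (G - lam)) (eta * (G + lam)) x\<bar> \<le> eta * s"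
  shows "lam * \<bar>x\<bar> \<le> G * v + s * \<bar>v\<bar> + lam * \<bar>x + v\<bar>"
proof -
  define p where "p = limit_clip (eta * (G - lam)) (eta * (G + lam)) x / eta"
  have lim: "limit_clip (eta * (G - lam)) (eta * (G + lam)) x = eta * p"
    using eta by (simp add: p_def)
  have ps: "\<bar>p\<bar> \<le> s" using le eta by (simp add: lim abs_mult)
  have "limit_clip (eta * (G - lam)) (eta * (G + lam)) x = eta * limit_clip (G - lam) (G + lam) x"
    using clip_scale[OF eta, of "G - lam" "G + lam" 0] by (simp add: limit_clip_def)
  then have p: "p = limit_clip (G - lam) (G + lam) x" using eta by (simp add: lim)
  have "\<bar>p - G\<bar> \<le> lam" "(p - G) * x = lam * \<bar>x\<bar>"
    using lam by (auto simp: p limit_clip_def clip_def max_def min_def)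
  then show ?thesis
    using coordinate_min_if_multipliers[of G "p - G" "- p" lam s x 0 v] ps by simp
qed

section \<open>The coordinate functions and their derivatives\<close>

context
  fixes G x :: "real^'n" and lam eta :: real
  assumes lam: "lam \<ge> 0" and eta: "eta > 0"
begin

abbreviation lo :: "'n \<Rightarrow> real" where "lo i \<equiv> eta * (G $ i - lam)"
abbreviation hi :: "'n \<Rightarrow> real" where "hi i \<equiv> eta * (G $ i + lam)"

definition initial_rate :: "'n \<Rightarrow> real" where
  "initial_rate i = sqrt (2 * eta * (- sotopo_J' G x lam eta i 0))"

definition final_rate :: "'n \<Rightarrow> real" where
  "final_rate i = sqrt (2 * eta * (- sotopo_J' G x lam eta i 1))"

lemma lo_le_hi: "lo i \<le> hi i"
  using lam eta by simp

lemma sotopo_g_eq_clip: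
  assumes "t \<ge> 0"
  shows "sotopo_g G x lam eta i t = - clip (t * lo i) (t * hi i) (x $ i)"
proof -
  have "t * eta * lam \<ge> 0" using assms lam eta by simp
  then show ?thesis
    unfolding sotopo_g_def clip_def
    by (auto simp: algebra_simps sgn_if max_def min_def abs_if)
qed

text \<open>
  The linear problem already has \<open>u\<close> as its minimizer; replacing \<open>s * \<bar>v\<bar>\<close> by the quadratic adds
  \<open>(\<bar>v\<bar> - \<bar>u\<bar>)\<^sup>2 / (2 * eta * t)\<close> up to a constant, which is smallest at \<open>u\<close> too.
\<close>

lemma sotopo_g_minimizes:
  fixes i :: 'n and v :: real
  assumes t: "t > 0"
  defines "u \<equiv> sotopo_g G x lam eta i t"
  shows "sotopo_J G x lam eta i t \<le>
    G $ i * v + 1 / (2 * eta) * (v\<^sup>2 / t) + lam * \<bar>x $ i + v\<bar>"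
proof -
  define s where "s = \<bar>u\<bar> / (t * eta)"
  have te: "t * eta > 0" using t eta by simp
  have us: "\<bar>u\<bar> = t * eta * s" using te t eta by (simp add: s_def)
  have "G $ i * u + s * \<bar>u\<bar> + lam * \<bar>x $ i + u\<bar> \<le> G $ i * v + s * \<bar>v\<bar> + lam * \<bar>x $ i + v\<bar>"
    using coordinate_min_clip[OF lam eta t, of "G $ i" "x $ i" v] t
    by (simp add: s_def u_def sotopo_g_eq_clip)
  moreover have "1 / (2 * eta) * (v\<^sup>2 / t) - s * \<bar>v\<bar> - (1 / (2 * eta) * (u\<^sup>2 / t) - s * \<bar>u\<bar>)
      = (\<bar>v\<bar> - \<bar>u\<bar>)\<^sup>2 / (2 * eta * t)"
  proof -
    have "s = \<bar>u\<bar> / (t * eta)" "u\<^sup>2 = \<bar>u\<bar>\<^sup>2" "v\<^sup>2 = \<bar>v\<bar>\<^sup>2" by (simp_all add: s_def)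
    then show ?thesis using t eta
      by (simp only:) (simp add: field_simps power2_eq_square del: abs_mult_self_eq abs_mult_self)
  qed
  moreover have "(\<bar>v\<bar> - \<bar>u\<bar>)\<^sup>2 / (2 * eta * t) \<ge> 0" using t eta by simp
  ultimately show ?thesis unfolding sotopo_J_def u_def[symmetric] by linarith
qed

lemma sotopo_J'_eq:
  assumes "(sotopo_J G x lam eta i has_field_derivative D) (at t within {0..1})" "t \<in> {0..1}"
  shows "sotopo_J' G x lam eta i t = D"
proof -
  have "(sotopo_J G x lam eta i has_vector_derivative D) (at t within cbox 0 1)"
    using assms(1) by (simp add: has_real_derivative_iff_has_vector_derivative)
  then have "vector_derivative (sotopo_J G x lam eta i) (at t within cbox 0 1) = D"
    using assms(2) by (intro vector_derivative_within_cbox) auto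
  then show ?thesis by (simp add: sotopo_J'_def)
qed

text \<open>
  Near \<open>0\<close> clipping has reached its limit \<open>p\<close>, so \<open>sotopo_g\<close> equals \<open>- t * p\<close> there and \<open>J\<close> is
  affine in \<open>t\<close> with slope \<open>- p\<^sup>2 / (2 * eta)\<close>.
\<close>

lemma initial_rate_eq: "initial_rate i = \<bar>limit_clip (lo i) (hi i) (x $ i)\<bar>"
proof -
  define p where "p = limit_clip (lo i) (hi i) (x $ i)"
  \<comment> \<open>A radius on which \<open>t * \<bar>p\<bar> \<le> \<bar>x $ i\<bar>\<close>; for \<open>x $ i = 0\<close> the affine formula holds for all \<open>t\<close>.\<close>
  define d where "d = (if x $ i = 0 then 1 else \<bar>x $ i\<bar> / (\<bar>p\<bar> + 1))"
  have J: "sotopo_J G x lam eta i t = lam * \<bar>x $ i\<bar> - p\<^sup>2 / (2 * eta) * t"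
    if t: "0 \<le> t" and small: "x $ i = 0 \<or> t * \<bar>p\<bar> \<le> \<bar>x $ i\<bar>" for t
  proof -
    have g: "sotopo_g G x lam eta i t = - (t * p)"
      using clip_eq_limit[OF lo_le_hi t] small t by (simp add: sotopo_g_eq_clip p_def)
    define r where "r = p / eta"
    have pr: "p = eta * r" using eta by (simp add: r_def)
    \<comment> \<open>\<open>r - G $ i\<close> is the slope of \<open>lam * \<bar>_\<bar>\<close> along the segment from \<open>x $ i\<close> to \<open>x $ i - t * p\<close>.\<close>
    have "lam * \<bar>x $ i - t * p\<bar> = lam * \<bar>x $ i\<bar> + (G $ i - r) * (t * p)"
    proof (cases "x $ i = 0")
      case True
      then have "p = eta * clip (G $ i - lam) (G $ i + lam) 0"
        using clip_scale[OF eta, of "G $ i - lam" "G $ i + lam" 0]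
        by (simp add: p_def limit_clip_def)
      then have "r = clip (G $ i - lam) (G $ i + lam) 0" using eta by (simp add: r_def)
      then have "lam * \<bar>r\<bar> = (G $ i - r) * r"
        using lam by (auto simp: clip_def max_def min_def)
      then have "t * eta * (lam * \<bar>r\<bar>) = t * eta * ((G $ i - r) * r)" by simp
      then show ?thesis
        using True t eta by (simp add: pr abs_mult algebra_simps)
    next
      case False
      have "\<bar>t * p\<bar> \<le> \<bar>x $ i\<bar>" using small False t by (simp add: abs_mult)
      moreover have "x $ i > 0 \<and> G $ i - r = - lam \<or> x $ i < 0 \<and> G $ i - r = lam"
        using False eta by (auto simp: r_def p_def limit_clip_def)
      ultimately show ?thesis
      proof (elim disjE conjE)
        assume "\<bar>t * p\<bar> \<le> \<bar>x $ i\<bar>" "x $ i > 0" and r: "G $ i - r = - lam"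
        then have "\<bar>x $ i - t * p\<bar> = \<bar>x $ i\<bar> - t * p" by linarith
        then show ?thesis unfolding r by (simp add: right_diff_distrib)
      next
        assume "\<bar>t * p\<bar> \<le> \<bar>x $ i\<bar>" "x $ i < 0" and r: "G $ i - r = lam"
        then have "\<bar>x $ i - t * p\<bar> = \<bar>x $ i\<bar> + t * p" by linarith
        then show ?thesis unfolding r by (simp add: distrib_left)
      qed
    qed
    moreover have "1 / (2 * eta) * ((t * p)\<^sup>2 / t) = t * p * r / 2"
      using eta by (cases "t = 0") (simp_all add: pr field_simps power2_eq_square)
    moreover have "p\<^sup>2 / (2 * eta) * t = t * p * r / 2"
      using eta by (simp add: pr field_simps power2_eq_square)
    moreover have "G $ i * - (t * p) + t * p * r / 2 + (G $ i - r) * (t * p) = - (t * p * r / 2)"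
      by (simp add: field_simps)
    ultimately show ?thesis
      unfolding sotopo_J_def g power2_minus add_uminus_conv_diff by linarith
  qed
  have d: "d > 0" by (simp add: d_def add_nonneg_pos)
  have "((\<lambda>t. lam * \<bar>x $ i\<bar> - p\<^sup>2 / (2 * eta) * t) has_field_derivative - (p\<^sup>2 / (2 * eta)))
      (at 0 within {0..1})"
    using eta by (auto intro!: derivative_eq_intros)
  then have "(sotopo_J G x lam eta i has_field_derivative - (p\<^sup>2 / (2 * eta))) (at 0 within {0..1})"
  proof (rule has_field_derivative_transform_within[OF _ d])
    fix t :: real assume t: "t \<in> {0..1}" "dist t 0 < d"
    have "t * \<bar>p\<bar> \<le> \<bar>x $ i\<bar>" if nz: "x $ i \<noteq> 0"
    proof -
      have "t * (\<bar>p\<bar> + 1) < \<bar>x $ i\<bar>"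
        using t nz by (simp add: d_def pos_less_divide_eq add_nonneg_pos)
      then show ?thesis using t by (simp add: distrib_left)
    qed
    then show "lam * \<bar>x $ i\<bar> - p\<^sup>2 / (2 * eta) * t = sotopo_J G x lam eta i t"
      using J[of t] t by (cases "x $ i = 0") simp_all
  qed simp
  then have "sotopo_J' G x lam eta i 0 = - (p\<^sup>2 / (2 * eta))" by (rule sotopo_J'_eq) simp
  then show ?thesis using eta by (simp add: initial_rate_def p_def)
qed

text \<open>
  \<open>J\<close> may be given by different formulas on the left of \<open>1\<close>, but it is a minimum over \<open>v\<close> of
  functions that depend smoothly on \<open>t\<close>. Inserting the minimizer for one of \<open>1\<close> and \<open>t\<close> into the
  problem for the other bounds the difference quotient from both sides (the envelope argument).
\<close>

lemma final_rate_eq: "final_rate i = \<bar>clip (lo i) (hi i) (x $ i)\<bar>"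
proof -
  define J where "J = sotopo_J G x lam eta i"
  define u where "u = sotopo_g G x lam eta i"
  let ?F = "at (1::real) within {0..1}"
  have lim: "(u \<longlongrightarrow> u 1) ?F"
  proof -
    have "((\<lambda>t. - clip (t * lo i) (t * hi i) (x $ i)) \<longlongrightarrow>
        - clip (1 * lo i) (1 * hi i) (x $ i)) ?F"
      unfolding clip_def by (intro tendsto_intros)
    moreover have "eventually (\<lambda>t. - clip (t * lo i) (t * hi i) (x $ i) = u t) ?F"
      by (auto simp: eventually_at_filter u_def sotopo_g_eq_clip)
    ultimately show ?thesis
      by (auto intro: Lim_transform_eventually simp: u_def sotopo_g_eq_clip)
  qed
  have ev: "eventually (\<lambda>t. 0 < t \<and> t < 1) ?F"
    unfolding eventually_at by (rule exI[of _ 1]) (auto simp: dist_real_def)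
  have J_eq: "J t = G $ i * u t + 1 / (2 * eta) * ((u t)\<^sup>2 / t) + lam * \<bar>x $ i + u t\<bar>" for t
    by (simp add: J_def u_def sotopo_J_def)
  have "((\<lambda>t. (J t - J 1) / (t - 1)) \<longlongrightarrow> - ((u 1)\<^sup>2 / (2 * eta))) ?F"
  proof (rule tendsto_sandwich)
    show "((\<lambda>t. - ((u 1)\<^sup>2 / (2 * eta * t))) \<longlongrightarrow> - ((u 1)\<^sup>2 / (2 * eta))) ?F"
      using eta by (auto intro!: tendsto_eq_intros)
    show "((\<lambda>t. - ((u t)\<^sup>2 / (2 * eta * t))) \<longlongrightarrow> - ((u 1)\<^sup>2 / (2 * eta))) ?F"
      using eta lim by (auto intro!: tendsto_eq_intros)
    have quot: "(y\<^sup>2 / (2 * eta)) * (1 / t - 1) = - (y\<^sup>2 / (2 * eta * t)) * (t - 1)"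
      if "t > 0" for y t :: real
      using that eta by (simp add: field_simps)
    show "eventually (\<lambda>t. - ((u 1)\<^sup>2 / (2 * eta * t)) \<le> (J t - J 1) / (t - 1)) ?F"
      using ev
    proof eventually_elim
      case (elim t)
      have "J t \<le> G $ i * u 1 + 1 / (2 * eta) * ((u 1)\<^sup>2 / t) + lam * \<bar>x $ i + u 1\<bar>"
        using sotopo_g_minimizes[of t i "u 1"] elim by (simp add: J_def)
      then have "J t - J 1 \<le> ((u 1)\<^sup>2 / (2 * eta)) * (1 / t - 1)"
        using J_eq[of 1] by (simp add: right_diff_distrib)
      then show ?case using elim quot[of t "u 1"] by (simp add: neg_le_divide_eq)
    qed
    show "eventually (\<lambda>t. (J t - J 1) / (t - 1) \<le> - ((u t)\<^sup>2 / (2 * eta * t))) ?F"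
      using ev
    proof eventually_elim
      case (elim t)
      have "J 1 \<le> G $ i * u t + 1 / (2 * eta) * ((u t)\<^sup>2 / 1) + lam * \<bar>x $ i + u t\<bar>"
        using sotopo_g_minimizes[of 1 i "u t"] by (simp add: J_def)
      then have "J t - J 1 \<ge> ((u t)\<^sup>2 / (2 * eta)) * (1 / t - 1)"
        using J_eq[of t] by (simp add: right_diff_distrib)
      then show ?case using elim quot[of t "u t"] by (simp add: neg_divide_le_eq)
    qed
  qed
  then have "sotopo_J' G x lam eta i 1 = - ((u 1)\<^sup>2 / (2 * eta))"
    by (intro sotopo_J'_eq) (auto simp: has_field_derivative_iff J_def)
  then show ?thesis using eta by (simp add: final_rate_def u_def sotopo_g_eq_clip)
qed

lemma
  assumes t: "0 < t" "t \<le> 1"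
  shows sotopo_g_ge_final: "t * final_rate i \<le> \<bar>sotopo_g G x lam eta i t\<bar>"
    and sotopo_g_le_initial: "\<bar>sotopo_g G x lam eta i t\<bar> \<le> t * initial_rate i"
    and sotopo_g_eq_final: "\<bar>x $ i\<bar> < t * final_rate i \<Longrightarrow>
      \<bar>sotopo_g G x lam eta i t\<bar> = t * final_rate i"
    and sotopo_g_eq_initial: "t * initial_rate i \<le> \<bar>x $ i\<bar> \<Longrightarrow>
      \<bar>sotopo_g G x lam eta i t\<bar> = t * initial_rate i"
    and sotopo_g_cancels: "final_rate i < initial_rate i \<Longrightarrow> t * final_rate i \<le> \<bar>x $ i\<bar> \<Longrightarrow>
      \<bar>x $ i\<bar> \<le> t * initial_rate i \<Longrightarrow> sotopo_g G x lam eta i t = - x $ i"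
  using clip_ge_final[OF lo_le_hi t] clip_le_limit[OF lo_le_hi t] clip_eq_final[OF lo_le_hi t]
    clip_eq_self[OF lo_le_hi t] clip_eq_limit[OF lo_le_hi, of t "x $ i" i] t
  by (simp_all add: sotopo_g_eq_clip final_rate_eq initial_rate_eq abs_mult)

lemma final_rate_nonneg: "final_rate i \<ge> 0"
  by (simp add: final_rate_eq)

lemma nonzero_if_rates_differ:
  assumes "final_rate i < initial_rate i"
  shows "x $ i \<noteq> 0"
  using assms by (auto simp: final_rate_eq initial_rate_eq limit_clip_def)

section \<open>Coordinatewise optimality at a common price\<close>

text \<open>
  The parameter is the total movement \<open>T\<close> rather than the price \<open>T / eta\<close>, so that it can be
  compared directly with the rates.
\<close>

definition optimal_at :: "real \<Rightarrow> 'n \<Rightarrow> real \<Rightarrow> bool" where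
  "optimal_at T i u \<longleftrightarrow> (\<forall>v. G $ i * u + T / eta * \<bar>u\<bar> + lam * \<bar>x $ i + u\<bar>
     \<le> G $ i * v + T / eta * \<bar>v\<bar> + lam * \<bar>x $ i + v\<bar>)"

text \<open>
  The square \<open>N\<^sup>2 / (2 * eta)\<close> lies above its tangent at \<open>N = T\<close>, and with the tangent in its
  place the objective is a sum over the coordinates.
\<close>

lemma minimizer_if_optimal_at:
  assumes norm: "l1_norm h = T" and opt: "\<And>i. optimal_at T i (h $ i)"
  shows "l1_square_objective G x lam eta h \<le> l1_square_objective G x lam eta g"
proof -
  have lin: "(\<Sum>i\<in>UNIV. G $ i * k $ i + T / eta * \<bar>k $ i\<bar> + lam * \<bar>x $ i + k $ i\<bar>)
      = G \<bullet> k + T / eta * l1_norm k + lam * l1_norm (x + k)" for k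
    by (simp add: inner_vec_def l1_norm_def sum.distrib sum_distrib_left)
  have "G \<bullet> h + T / eta * l1_norm h + lam * l1_norm (x + h)
      \<le> G \<bullet> g + T / eta * l1_norm g + lam * l1_norm (x + g)"
    unfolding lin[symmetric] using opt by (intro sum_mono) (simp add: optimal_at_def)
  moreover have "1 / (2 * eta) * (l1_norm g)\<^sup>2 - T / eta * l1_norm g
      - (1 / (2 * eta) * T\<^sup>2 - T / eta * T) = (l1_norm g - T)\<^sup>2 / (2 * eta)"
    using eta by (simp add: field_simps power2_eq_square)
  moreover have "(l1_norm g - T)\<^sup>2 / (2 * eta) \<ge> 0" using eta by simp
  ultimately show ?thesis unfolding l1_square_objective_def norm by linarith
qed

lemma optimal_at_zero:
  assumes "initial_rate i \<le> T"
  shows "optimal_at T i 0"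
  using assms coordinate_min_zero[OF lam eta, of "G $ i" "x $ i" "T / eta"] eta
  by (simp add: optimal_at_def initial_rate_eq)

lemma optimal_at_g:
  assumes t: "t > 0" and "\<bar>sotopo_g G x lam eta i t\<bar> = t * T"
  shows "optimal_at T i (sotopo_g G x lam eta i t)"
proof -
  have "\<bar>sotopo_g G x lam eta i t\<bar> / (t * eta) = T / eta" using assms by simp
  then show ?thesis
    using coordinate_min_clip[OF lam eta t, of "G $ i" "x $ i"] t
    by (simp add: optimal_at_def sotopo_g_eq_clip)
qed

text \<open>
  The budget \<open>\<bar>x $ i\<bar> / T\<close> is the one at which \<open>sotopo_g\<close> cancels \<open>x $ i\<close> at the ratio \<open>T\<close>.
\<close>

lemma optimal_at_cancel:
  assumes "final_rate i < initial_rate i" "final_rate i \<le> T" "T \<le> initial_rate i" "T \<ge> \<bar>x $ i\<bar>"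
  shows "optimal_at T i (- x $ i)"
proof -
  define t where "t = \<bar>x $ i\<bar> / T"
  have T: "T > 0" using nonzero_if_rates_differ[OF assms(1)] assms(4) by simp
  have t: "t > 0" "t \<le> 1" and tT: "\<bar>x $ i\<bar> = t * T"
    using nonzero_if_rates_differ[OF assms(1)] T assms(4) by (auto simp: t_def)
  have "sotopo_g G x lam eta i t = - x $ i"
    using t assms tT by (intro sotopo_g_cancels) (auto intro: mult_left_mono)
  then show ?thesis using optimal_at_g[of t i T] t tT by simp
qed

section \<open>The stopping rule\<close>

context
  fixes im :: 'n and qs :: "'n list"
  assumes choice: "sotopo_choice G x lam eta im qs"
begin

abbreviation "Q \<equiv> sotopo_Q G x lam eta"
abbreviation "idx \<equiv> sotopo_idx im qs"
abbreviation "R \<equiv> sotopo_R im qs"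
abbreviation "rho \<equiv> sotopo_rho G x lam eta im qs"
abbreviation "last_i \<equiv> sotopo_last G x lam eta im qs"

text \<open>The coordinates at the positions before \<open>rho\<close>; the one at \<open>rho\<close> may be among them.\<close>

definition moved :: "'n set" where
  "moved = R (rho - 1)"

text \<open>The right-hand side of the stopping test at \<open>rho\<close>, in the units of the rates.\<close>

definition threshold :: real where
  "threshold = sqrt (2 * eta * sotopo_v G x lam eta im qs rho)"

definition l1_on :: "'n set \<Rightarrow> real" where
  "l1_on A = (\<Sum>l\<in>A. \<bar>x $ l\<bar>)"

lemma distinct_qs: "distinct qs" and set_qs: "set qs = Q"
  using choice by (auto simp: sotopo_choice_def)

lemma vm_eq: "sqrt (2 * eta * sotopo_vm G x lam eta) = final_rate im"
  using choice by (simp add: sotopo_choice_def final_rate_def)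

lemma final_rate_le: "final_rate i \<le> final_rate im"
proof -
  have "- sotopo_J' G x lam eta i 1 \<le> sotopo_vm G x lam eta"
    unfolding sotopo_vm_def by (rule Max_ge) auto
  then show ?thesis unfolding vm_eq[symmetric] unfolding final_rate_def
    using eta by (intro real_sqrt_le_mono mult_left_mono) auto
qed

text \<open>
  In particular \<open>initial_rate\<close> exceeds \<open>final_rate\<close> for the members of \<open>Q\<close>, so these have a nonzero
  entry of \<open>x\<close> and can be cancelled.
\<close>

lemma mem_Q_iff: "i \<in> Q \<longleftrightarrow> final_rate im < initial_rate i"
proof -
  have "i \<in> Q \<longleftrightarrow> 2 * eta * sotopo_vm G x lam eta < 2 * eta * (- sotopo_J' G x lam eta i 0)"
    using eta unfolding sotopo_Q_def by (subst mult_less_cancel_left_pos) auto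
  then show ?thesis unfolding vm_eq[symmetric] initial_rate_def by simp
qed

lemma R_eq_take: "j \<le> length qs \<Longrightarrow> R j = set (take j qs)"
proof -
  assume j: "j \<le> length qs"
  have "R j = (\<lambda>k. qs ! (k - 1)) ` {1..j}"
    unfolding sotopo_R_def using j by (intro image_cong) (auto simp: sotopo_idx_def)
  also have "\<dots> = (\<lambda>k. qs ! k) ` ((\<lambda>k. k - 1) ` {1..j})" by (simp add: image_image)
  also have "(\<lambda>k. k - 1) ` {1..j} = {0..<j}"
    by (force simp: image_iff Bex_def intro: exI[of _ "Suc _"])
  also have "(\<lambda>k. qs ! k) ` {0..<j} = set (take j qs)" using j by (rule nth_image)
  finally show ?thesis .
qed

lemma R_Suc: "R (Suc j) = insert (idx (Suc j)) (R j)"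
  unfolding sotopo_R_def by (simp add: atLeastAtMostSuc_conv)

lemma initial_rate_antimono:
  assumes "j \<le> k" "k < length qs"
  shows "initial_rate (qs ! k) \<le> initial_rate (qs ! j)"
proof (cases "j = k")
  case False
  have "sorted_wrt (\<lambda>k l. - sotopo_J' G x lam eta k 0 \<ge> - sotopo_J' G x lam eta l 0) qs"
    using choice by (simp add: sotopo_choice_def)
  then have "- sotopo_J' G x lam eta (qs ! j) 0 \<ge> - sotopo_J' G x lam eta (qs ! k) 0"
    using assms False by (auto simp: sorted_wrt_iff_nth_less)
  then show ?thesis unfolding initial_rate_def using eta by simp
qed simp

lemma
  shows rho_range: "rho \<in> {1..length qs + 1}"
    and rho_stops: "sotopo_J' G x lam eta (idx rho) 0 = sotopo_J' G x lam eta (idx rho) 1 \<or>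
      sqrt (2 * eta * sotopo_v G x lam eta im qs rho) \<le> l1_on (R rho) \<or> rho = length qs + 1"
    and before_rho: "j \<in> {1..<rho} \<Longrightarrow> l1_on (R j) < sqrt (2 * eta * sotopo_v G x lam eta im qs j)"
proof -
  define stop where "stop j \<longleftrightarrow> j \<in> {1..length qs + 1} \<and>
     (sotopo_J' G x lam eta (idx j) 0 = sotopo_J' G x lam eta (idx j) 1 \<or>
      (\<Sum>l\<in>R j. \<bar>x $ l\<bar>) \<ge> sqrt (2 * eta * sotopo_v G x lam eta im qs j) \<or>
      j = length qs + 1)" for j
  have rho: "rho = (LEAST j. stop j)" by (simp add: sotopo_rho_def stop_def)
  have "stop (length qs + 1)" by (simp add: stop_def)
  then have "stop rho" unfolding rho by (rule LeastI)
  then show range: "rho \<in> {1..length qs + 1}"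
    and "sotopo_J' G x lam eta (idx rho) 0 = sotopo_J' G x lam eta (idx rho) 1 \<or>
      sqrt (2 * eta * sotopo_v G x lam eta im qs rho) \<le> l1_on (R rho) \<or> rho = length qs + 1"
    by (auto simp: stop_def l1_on_def)
  assume j: "j \<in> {1..<rho}"
  then have "\<not> stop j" unfolding rho by (auto dest: not_less_Least)
  then show "l1_on (R j) < sqrt (2 * eta * sotopo_v G x lam eta im qs j)"
    using j range by (auto simp: stop_def l1_on_def)
qed

lemma threshold_before_end: "rho \<le> length qs \<Longrightarrow> threshold = initial_rate last_i"
  by (simp add: threshold_def sotopo_v_def sotopo_last_def initial_rate_def)

lemma threshold_at_end: "rho = length qs + 1 \<Longrightarrow> threshold = final_rate im"
  by (simp add: threshold_def sotopo_v_def vm_eq)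

lemma R_rho: "R rho = insert last_i moved"
  using R_Suc[of "rho - 1"] rho_range by (simp add: moved_def sotopo_last_def)

lemma moved_eq: "moved = set (take (rho - 1) qs)"
  unfolding moved_def using rho_range by (intro R_eq_take) auto

lemma last_before_end:
  assumes "rho \<le> length qs"
  shows "last_i = qs ! (rho - 1)"
  using assms by (simp add: sotopo_last_def sotopo_idx_def)

text \<open>
  The first stopping condition, equality of the two derivatives, cannot occur inside \<open>Q\<close>; hence
  the cancelled mass must have reached the threshold.
\<close>

lemma stops_before_end:
  assumes "rho \<le> length qs"
  shows "last_i \<in> Q" "last_i \<notin> moved" "threshold \<le> l1_on moved + \<bar>x $ last_i\<bar>"
proof -
  have r: "rho - 1 < length qs" using assms rho_range by auto
  show Q: "last_i \<in> Q" unfolding last_before_end[OF assms] set_qs[symmetric] using r by (rule nth_mem)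
  show nm: "last_i \<notin> moved"
    using distinct_qs r unfolding moved_eq last_before_end[OF assms]
    by (auto simp: in_set_conv_nth nth_eq_iff_index_eq)
  have "final_rate last_i < initial_rate last_i"
    using Q final_rate_le[of last_i] by (simp add: mem_Q_iff)
  then have "sotopo_J' G x lam eta last_i 0 \<noteq> sotopo_J' G x lam eta last_i 1"
    by (auto simp: initial_rate_def final_rate_def)
  then have "threshold \<le> l1_on (R rho)"
    using rho_stops assms by (auto simp: threshold_def sotopo_last_def)
  also have "l1_on (R rho) = l1_on moved + \<bar>x $ last_i\<bar>"
    using nm by (simp add: l1_on_def R_rho)
  finally show "threshold \<le> l1_on moved + \<bar>x $ last_i\<bar>" .
qed

text \<open>
  Here \<open>im\<close> may itself belong to \<open>Q\<close>, so that \<open>last_i \<in> moved\<close> is possible.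
\<close>

lemma stops_at_end:
  assumes "rho = length qs + 1"
  shows "last_i = im" "moved = Q"
  using assms by (simp_all add: sotopo_last_def sotopo_idx_def moved_eq set_qs)

lemma moved_subset: "moved \<subseteq> Q"
  unfolding moved_eq set_qs[symmetric] by (rule set_take_subset)

lemma final_rate_le_threshold: "final_rate i \<le> threshold"
proof (cases "rho \<le> length qs")
  case True
  then show ?thesis
    using stops_before_end(1) final_rate_le[of i] threshold_before_end by (simp add: mem_Q_iff)
next
  case False
  then have "rho = length qs + 1" using rho_range by auto
  then show ?thesis using final_rate_le threshold_at_end by simp
qed

text \<open>
  The stopping test failed at position \<open>rho - 1\<close>, and the threshold there is the smallest initial
  rate among the coordinates in \<open>moved\<close>. The threshold at \<open>rho\<close> is no larger, by the sorting or,
  at the end, by the definition of \<open>Q\<close>.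
\<close>

lemma initial_rate_of_moved:
  assumes "i \<in> moved"
  shows "threshold \<le> initial_rate i" "l1_on moved < initial_rate i"
proof -
  obtain k where k: "i = qs ! k" "k < rho - 1" "k < length qs"
    using assms by (auto simp: moved_eq in_set_conv_nth)
  have r: "rho - 1 \<in> {1..<rho}" "rho - 1 \<le> length qs" using k rho_range by auto
  have "l1_on moved < sqrt (2 * eta * sotopo_v G x lam eta im qs (rho - 1))"
    using before_rho[OF r(1)] by (simp add: moved_def)
  also have "\<dots> = initial_rate (qs ! (rho - 1 - 1))"
    using r by (simp add: sotopo_v_def sotopo_idx_def initial_rate_def)
  also have "\<dots> \<le> initial_rate i"
    unfolding k(1) using k r by (intro initial_rate_antimono) auto
  finally show "l1_on moved < initial_rate i" .
  show "threshold \<le> initial_rate i"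
  proof (cases "rho \<le> length qs")
    case True
    then show ?thesis
      using k unfolding k(1) threshold_before_end[OF True] last_before_end[OF True]
      by (intro initial_rate_antimono) auto
  next
    case False
    then have "rho = length qs + 1" using rho_range by auto
    then show ?thesis
      using assms moved_subset threshold_at_end by (force simp: mem_Q_iff)
  qed
qed

lemma initial_rate_of_not_moved:
  assumes "i \<notin> moved"
  shows "initial_rate i \<le> threshold"
proof (cases "i \<in> Q")
  case True
  then obtain k where k: "i = qs ! k" "k < length qs"
    by (auto simp: set_qs[symmetric] in_set_conv_nth)
  have kr: "\<not> k < rho - 1" using assms k by (auto simp: moved_eq in_set_conv_nth)
  then have le: "rho \<le> length qs" using k by simp
  then show ?thesis
    using k kr unfolding k(1) threshold_before_end[OF le] last_before_end[OF le]
    by (intro initial_rate_antimono) auto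
next
  case False
  then show ?thesis using final_rate_le_threshold[of im] by (simp add: mem_Q_iff)
qed

section \<open>The output\<close>

text \<open>This will be the $\ell_1$-norm of the output.\<close>

definition total :: real where
  "total = max (l1_on moved) threshold"

lemma l1_on_nonneg: "l1_on A \<ge> 0"
  by (simp add: l1_on_def sum_nonneg)

lemma total_nonneg: "total \<ge> 0"
  using l1_on_nonneg[of moved] by (simp add: total_def)

lemma sqrt_gamma: "sqrt (2 * eta * sotopo_gamma G x lam eta im qs) = total"
  using l1_on_nonneg[of moved] eta
  by (auto simp: sotopo_gamma_def total_def threshold_def l1_on_def moved_def)

abbreviation "zeroed \<equiv> sotopo_zeroed G x lam eta im qs"

lemma zeroed_eq: "zeroed = moved - {last_i}"
  by (auto simp: sotopo_zeroed_def R_rho)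

lemma rates_of_moved:
  assumes "i \<in> moved"
  shows "final_rate i < initial_rate i" "final_rate i \<le> total" "total \<le> initial_rate i"
    "\<bar>x $ i\<bar> \<le> total"
proof -
  show "final_rate i < initial_rate i"
    using assms moved_subset final_rate_le[of i] by (force simp: mem_Q_iff)
  show "final_rate i \<le> total" using final_rate_le_threshold[of i] by (simp add: total_def)
  show "total \<le> initial_rate i" using initial_rate_of_moved[OF assms] by (simp add: total_def)
  have "\<bar>x $ i\<bar> \<le> l1_on moved"
    unfolding l1_on_def using assms by (intro member_le_sum) auto
  then show "\<bar>x $ i\<bar> \<le> total" by (simp add: total_def)
qed

text \<open>
  The budget \<open>t\<close> left for the last coordinate satisfies \<open>t * total = total - l1_on zeroed\<close>, so both
  claims follow once \<open>sotopo_g\<close> at \<open>t\<close> has ratio \<open>total\<close>. If the coordinate is also in \<open>moved\<close>,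
  then stopping occurred at the end. Either \<open>total\<close> is the cancelled mass, and \<open>t\<close> is exactly
  the budget that cancels this coordinate, or it is the threshold, and \<open>t\<close> exceeds
  \<open>\<bar>x $ last_i\<bar> / total\<close>, so that the coordinate crosses zero and moves at its final rate. If it is
  not in \<open>moved\<close>, a positive budget forces \<open>total\<close> to be the threshold. Stopping inside
  \<open>Q\<close> then means that the coordinate does not get beyond zero and moves at its initial rate;
  stopping at the end means that its two rates agree.
\<close>

lemma last_coordinate:
  defines "t \<equiv> 1 - l1_on zeroed / total"
  defines "u \<equiv> sotopo_g G x lam eta last_i t"
  shows "l1_on zeroed + \<bar>u\<bar> = total" "optimal_at total last_i u"
proof -
  have Zle: "l1_on zeroed \<le> l1_on moved"
    unfolding l1_on_def zeroed_eq by (intro sum_mono2) auto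
  then have ZT: "l1_on zeroed \<le> total" by (simp add: total_def)
  have t: "0 \<le> t" "t \<le> 1"
    using ZT total_nonneg l1_on_nonneg[of zeroed] by (auto simp: t_def divide_le_eq)
  \<comment> \<open>If \<open>total = 0\<close>, division by zero yields \<open>t = 1\<close>, and both sides vanish.\<close>
  have tT: "t * total = total - l1_on zeroed"
    using ZT l1_on_nonneg[of zeroed] by (cases "total = 0") (auto simp: t_def algebra_simps)
  have split: "l1_on moved = l1_on zeroed + \<bar>x $ last_i\<bar>" if "last_i \<in> moved"
    using that by (simp add: zeroed_eq l1_on_def sum.remove)
  have same: "l1_on moved = l1_on zeroed" if "last_i \<notin> moved"
    using that by (simp add: zeroed_eq)
  have "\<bar>u\<bar> = t * total \<and> optimal_at total last_i u"
  proof (cases "t = 0")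
    case True
    \<comment> \<open>No budget is left, so the cancelled mass is already \<open>total\<close>; as the entries of \<open>x\<close> on \<open>moved\<close>
      are nonzero, the last coordinate cannot be one of them.\<close>
    have u: "u = 0" using True by (simp add: u_def sotopo_g_eq_clip clip_def)
    have "last_i \<notin> moved"
    proof
      assume "last_i \<in> moved"
      then show False
        using split nonzero_if_rates_differ[OF rates_of_moved(1)] True tT
        by (simp add: total_def max_def split: if_splits)
    qed
    then have "initial_rate last_i \<le> total"
      using initial_rate_of_not_moved by (simp add: total_def max.coboundedI2)
    then show ?thesis using True u optimal_at_zero by simp
  next
    case False
    then have t0: "t > 0" using t by simp
    have "\<bar>u\<bar> = t * total"
    proof (cases "last_i \<in> moved")
      case moved: True
      then have "rho = length qs + 1"
        using stops_before_end(2) rho_range by (cases "rho \<le> length qs") auto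
      then have thr: "threshold = final_rate last_i"
        using threshold_at_end stops_at_end(1) by simp
      show ?thesis
      proof (cases "threshold \<le> l1_on moved")
        case True
        then have share: "\<bar>x $ last_i\<bar> = t * total"
          using tT split[OF moved] by (simp add: total_def)
        have "u = - x $ last_i"
          unfolding u_def using rates_of_moved[OF moved] t0 t
          by (intro sotopo_g_cancels) (auto simp: share)
        then show ?thesis using share by simp
      next
        case False
        then have T: "total = final_rate last_i" by (simp add: total_def thr)
        have "\<bar>x $ last_i\<bar> < t * total"
          using tT split[OF moved] False by (simp add: total_def)
        then show ?thesis
          unfolding u_def T using t0 t by (intro sotopo_g_eq_final)
      qed
    next
      case not_moved: False
      \<comment> \<open>For \<open>total = 0\<close> the threshold is also \<open>0\<close>, because it is at least a final rate.\<close>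
      have "t * total > 0 \<or> total = 0" using t0 total_nonneg by auto
      then have T: "total = threshold"
        using tT same[OF not_moved] l1_on_nonneg[of moved] final_rate_nonneg[of im]
          final_rate_le_threshold[of im] by (auto simp: total_def max_def split: if_splits)
      show ?thesis
      proof (cases "rho \<le> length qs")
        case True
        have "t * total \<le> \<bar>x $ last_i\<bar>"
          using tT same[OF not_moved] stops_before_end(3)[OF True] T by simp
        then show ?thesis
          unfolding u_def T threshold_before_end[OF True] using t0 t
          by (intro sotopo_g_eq_initial)
      next
        case False
        then have "rho = length qs + 1" using rho_range by auto
        then have F: "total = final_rate last_i"
          using T threshold_at_end stops_at_end(1) by simp
        have "t * initial_rate last_i \<le> t * total"
          using initial_rate_of_not_moved[OF not_moved] T t0 by simp
        then show ?thesis
          using sotopo_g_ge_final[OF t0 t(2), of last_i] sotopo_g_le_initial[OF t0 t(2), of last_i]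
          unfolding u_def F by linarith
      qed
    qed
    then show ?thesis unfolding u_def using optimal_at_g[OF t0] by simp
  qed
  then show "l1_on zeroed + \<bar>u\<bar> = total" "optimal_at total last_i u" using tT by auto
qed

lemma sotopo_h_nth:
  "sotopo_h G x lam eta im qs $ l =
    (if l \<in> zeroed then - x $ l
     else if l = last_i then sotopo_g G x lam eta last_i (1 - l1_on zeroed / total)
     else 0)"
  by (simp add: sotopo_h_def sotopo_theta_def sqrt_gamma l1_on_def sum_divide_distrib zeroed_eq)

lemma l1_norm_sotopo_h: "l1_norm (sotopo_h G x lam eta im qs) = total"
proof -
  let ?h = "sotopo_h G x lam eta im qs"
  have nz: "last_i \<notin> zeroed" by (simp add: zeroed_eq)
  have "l1_norm ?h = (\<Sum>l\<in>insert last_i zeroed. \<bar>?h $ l\<bar>)"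
    unfolding l1_norm_def by (rule sum.mono_neutral_right) (auto simp: sotopo_h_nth)
  also have "\<dots> = \<bar>?h $ last_i\<bar> + l1_on zeroed"
    using nz by (simp add: l1_on_def sotopo_h_nth)
  also have "\<dots> = total" using last_coordinate(1) nz by (simp add: sotopo_h_nth)
  finally show ?thesis .
qed

lemma optimal_at_sotopo_h: "optimal_at total i (sotopo_h G x lam eta im qs $ i)"
proof -
  consider "i \<in> zeroed" | "i = last_i" "i \<notin> zeroed" | "i \<notin> moved" "i \<notin> zeroed" "i \<noteq> last_i"
    by (auto simp: zeroed_eq)
  then show ?thesis
  proof cases
    case 1
    then have "i \<in> moved" by (simp add: zeroed_eq)
    then show ?thesis
      using 1 optimal_at_cancel[OF rates_of_moved] by (simp add: sotopo_h_nth)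
  next
    case 2
    then show ?thesis using last_coordinate(2) by (simp add: sotopo_h_nth)
  next
    case 3
    then have "initial_rate i \<le> total"
      using initial_rate_of_not_moved by (simp add: total_def max.coboundedI2)
    then show ?thesis using 3 optimal_at_zero by (simp add: sotopo_h_nth)
  qed
qed

lemma sotopo_h_minimizes:
  "l1_square_objective G x lam eta (sotopo_h G x lam eta im qs) \<le> l1_square_objective G x lam eta g"
  using l1_norm_sotopo_h optimal_at_sotopo_h by (rule minimizer_if_optimal_at)

end

end

theorem theorem1:
  fixes f :: "real^'n \<Rightarrow> real" and nabla_f :: "real^'n \<Rightarrow> real^'n"
    and x h x' :: "real^'n" and lam eta :: real
  assumes "convex_on UNIV f"
    and "\<forall>y. GDERIV f y :> nabla_f y"
    and "lam \<ge> 0" and "eta > 0"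
    and "sotopo_output (nabla_f x) x lam eta h x'"
  shows "(\<forall>g. l1_square_objective (nabla_f x) x lam eta h
                \<le> l1_square_objective (nabla_f x) x lam eta g)
         \<and> x' = x + h"
proof -
  obtain im qs where choice: "sotopo_choice (nabla_f x) x lam eta im qs"
    and h: "h = sotopo_h (nabla_f x) x lam eta im qs"
    and x': "x' = sotopo_x (nabla_f x) x lam eta im qs"
    using assms(5) by (auto simp: sotopo_output_def)
  have "x' = x + h" by (simp add: h x' sotopo_h_def sotopo_x_def vec_eq_iff)
  then show ?thesis using sotopo_h_minimizes[OF assms(3,4) choice] h by simp
qed

end
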